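(* Let $(X,\bullet)$ be any groupoid. Then the $AU$-factorization of $(X,\bullet)$ is unique: there is exactly one pair of groupoids $(X,\circ)$, $(X,\ast)$ such that $(X,\circ)$ is a similar-factor of $(X,\bullet)$, $(X,\ast)$ is a signature-factor of $(X,\bullet)$, and $(X,\bullet)=(X,\circ)\diamond(X,\ast)$.
   Context: A groupoid $(X,\bullet)$ is a non-empty set $X$ with an arbitrary binary operation $\bullet:X\times X\to X$. For groupoids $(X,\ast_1)$, $(X,\ast_2)$ on the same set $X$, the product $(X,\ast_1)\diamond(X,\ast_2)$ is the groupoid $(X,\cdot)$ with $x\cdot y=(x\ast_1 y)\ast_2(y\ast_1 x)$ for all $x,y\in X$. A groupoid $(X,\ast)$ is a signature-factor of $(X,\bullet)$ if $x\ast x=x$ for all $x$ and $x\ast y=x\bullet y$ for all $x\neq y$. A groupoid $(X,\circ)$ is a similar-factor of $(X,\bullet)$ if $x\circ x=x\bullet x$ for all $x$ and $x\circ y=x$ for all $x\neq y$. *)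

theory Defs
  imports Main "HOL-Library.FuncSet"
begin

text \<open>
  A groupoid is a non-empty carrier \<open>X\<close> with a binary operation on \<open>X\<close>. Operations are
  taken from the extensional function space, so that two operations are equal as HOL
  functions exactly if they agree on \<open>X \<times> X\<close>; in particular equality of groupoids on the
  same carrier is equality of their operations.
\<close>
definition groupoid :: "'a set \<Rightarrow> ('a \<Rightarrow> 'a \<Rightarrow> 'a) \<Rightarrow> bool" where
  "groupoid X f \<longleftrightarrow> X \<noteq> {} \<and> f \<in> X \<rightarrow>\<^sub>E (X \<rightarrow>\<^sub>E X)"

definition groupoid_product ::
  "'a set \<Rightarrow> ('a \<Rightarrow> 'a \<Rightarrow> 'a) \<Rightarrow> ('a \<Rightarrow> 'a \<Rightarrow> 'a) \<Rightarrow> ('a \<Rightarrow> 'a \<Rightarrow> 'a)" where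
  "groupoid_product X f g = (\<lambda>x\<in>X. \<lambda>y\<in>X. g (f x y) (f y x))"

definition signature_factor ::
  "'a set \<Rightarrow> ('a \<Rightarrow> 'a \<Rightarrow> 'a) \<Rightarrow> ('a \<Rightarrow> 'a \<Rightarrow> 'a) \<Rightarrow> bool" where
  "signature_factor X s b \<longleftrightarrow> groupoid X s \<and>
     (\<forall>x\<in>X. s x x = x) \<and> (\<forall>x\<in>X. \<forall>y\<in>X. x \<noteq> y \<longrightarrow> s x y = b x y)"

definition similar_factor ::
  "'a set \<Rightarrow> ('a \<Rightarrow> 'a \<Rightarrow> 'a) \<Rightarrow> ('a \<Rightarrow> 'a \<Rightarrow> 'a) \<Rightarrow> bool" where
  "similar_factor X c b \<longleftrightarrow> groupoid X c \<and>
     (\<forall>x\<in>X. c x x = b x x) \<and> (\<forall>x\<in>X. \<forall>y\<in>X. x \<noteq> y \<longrightarrow> c x y = x)"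

end

theory Submission
  imports Defs
begin

text \<open>The conditions on a similar-factor prescribe its value at each diagonal and each
  off-diagonal pair, and likewise for a signature-factor. So \<open>b\<close> has exactly one factor
  of each kind, and only the product equation remains. Off the diagonal, \<open>c\<close> returns
  its left argument, so \<open>s (c x y) (c y x)\<close> is \<open>s x y = b x y\<close>. On the
  diagonal it is \<open>s (b x x) (b x x)\<close>, which idempotence of \<open>s\<close> turns into
  \<open>b x x\<close>. This computation is
  \<open>groupoid_product_similar_signature\<close>.\<close>

lemma groupoid_ext:
  assumes "groupoid X f" "groupoid X g" and "\<And>x y. x \<in> X \<Longrightarrow> y \<in> X \<Longrightarrow> f x y = g x y"
  shows "f = g"
proof (rule PiE_ext)
  show "f \<in> X \<rightarrow>\<^sub>E (X \<rightarrow>\<^sub>E X)" "g \<in> X \<rightarrow>\<^sub>E (X \<rightarrow>\<^sub>E X)"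
    using assms by (simp_all add: groupoid_def)
  fix x assume x: "x \<in> X"
  show "f x = g x"
  proof (rule PiE_ext)
    show "f x \<in> X \<rightarrow>\<^sub>E X" "g x \<in> X \<rightarrow>\<^sub>E X"
      using assms(1,2) x by (auto simp: groupoid_def)
  qed (rule assms(3)[OF x])
qed

lemma groupoid_closed:
  "groupoid X f \<Longrightarrow> x \<in> X \<Longrightarrow> y \<in> X \<Longrightarrow> f x y \<in> X"
  by (auto simp: groupoid_def)

text \<open>Serves both explicit factors and the product, all of which are restricted abstractions:
  extensionality is then automatic and only closure has to be checked.\<close>

lemma groupoid_restrict:
  assumes "X \<noteq> {}" and "\<And>x y. x \<in> X \<Longrightarrow> y \<in> X \<Longrightarrow> f x y \<in> X"
  shows "groupoid X (\<lambda>x\<in>X. \<lambda>y\<in>X. f x y)"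
  using assms by (auto simp: groupoid_def)

text \<open>The cases \<open>x = y\<close> and \<open>x \<noteq> y\<close> exhaust
  \<open>X \<times> X\<close>, and in each the value is dictated by \<open>b\<close> or by
  \<open>x\<close>.\<close>

lemma similar_factor_unique:
  assumes "similar_factor X c b" "similar_factor X c' b"
  shows "c = c'"
proof (rule groupoid_ext)
  show "groupoid X c" "groupoid X c'"
    using assms by (simp_all add: similar_factor_def)
  show "c x y = c' x y" if "x \<in> X" "y \<in> X" for x y
    using assms that by (cases "x = y") (simp_all add: similar_factor_def)
qed

lemma signature_factor_unique:
  assumes "signature_factor X s b" "signature_factor X s' b"
  shows "s = s'"
proof (rule groupoid_ext)
  show "groupoid X s" "groupoid X s'"
    using assms by (simp_all add: signature_factor_def)
  show "s x y = s' x y" if "x \<in> X" "y \<in> X" for x y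
    using assms that by (cases "x = y") (simp_all add: signature_factor_def)
qed

lemma similar_factor_exists:
  assumes "groupoid X b"
  shows "similar_factor X (\<lambda>x\<in>X. \<lambda>y\<in>X. if x = y then b x x else x) b"
proof -
  have "X \<noteq> {}"
    using assms by (simp add: groupoid_def)
  then have "groupoid X (\<lambda>x\<in>X. \<lambda>y\<in>X. if x = y then b x x else x)"
    by (rule groupoid_restrict) (simp add: groupoid_closed[OF assms])
  then show ?thesis
    by (simp add: similar_factor_def)
qed

lemma signature_factor_exists:
  assumes "groupoid X b"
  shows "signature_factor X (\<lambda>x\<in>X. \<lambda>y\<in>X. if x = y then x else b x y) b"
proof -
  have "X \<noteq> {}"
    using assms by (simp add: groupoid_def)
  then have "groupoid X (\<lambda>x\<in>X. \<lambda>y\<in>X. if x = y then x else b x y)"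
    by (rule groupoid_restrict) (simp add: groupoid_closed[OF assms])
  then show ?thesis
    by (simp add: signature_factor_def)
qed

text \<open>Stated for arbitrary factors of the two kinds, so the explicit formulas of the existence
  lemmas do not enter the computation.\<close>

lemma groupoid_product_similar_signature:
  assumes b: "groupoid X b" and c: "similar_factor X c b" and s: "signature_factor X s b"
  shows "groupoid_product X c s = b"
proof (rule groupoid_ext)
  have c': "groupoid X c" and s': "groupoid X s"
    using c s by (simp_all add: similar_factor_def signature_factor_def)
  show "groupoid X (groupoid_product X c s)"
    unfolding groupoid_product_def
  proof (rule groupoid_restrict)
    show "X \<noteq> {}"
      using b by (simp add: groupoid_def)
  qed (simp add: groupoid_closed[OF c'] groupoid_closed[OF s'])
  show "groupoid_product X c s x y = b x y" if "x \<in> X" "y \<in> X" for x y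
    \<comment> \<open>Closure of \<open>b\<close> matters on the diagonal: \<open>s\<close> is
      idempotent only on \<open>X\<close>, so \<open>b x x \<in> X\<close> is required to reduce
      \<open>s (b x x) (b x x)\<close>.\<close>
    using c s that groupoid_closed[OF b]
    by (cases "x = y")
      (simp_all add: groupoid_product_def similar_factor_def signature_factor_def)
qed (fact b)

theorem corollary3p2p4:
  fixes X :: "'a set" and b :: "'a \<Rightarrow> 'a \<Rightarrow> 'a"
  assumes "groupoid X b"
  shows "\<exists>!p. case p of (c, s) \<Rightarrow>
           similar_factor X c b \<and> signature_factor X s b \<and> b = groupoid_product X c s"
proof -
  obtain c s where c: "similar_factor X c b" and s: "signature_factor X s b"
    using similar_factor_exists signature_factor_exists assms by blast
  show ?thesis
  proof (rule ex1I[of _ "(c, s)"])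
    show "case (c, s) of (c, s) \<Rightarrow>
        similar_factor X c b \<and> signature_factor X s b \<and> b = groupoid_product X c s"
      by (simp add: c s groupoid_product_similar_signature[OF assms c s])
    show "p = (c, s)" if "case p of (c, s) \<Rightarrow>
        similar_factor X c b \<and> signature_factor X s b \<and> b = groupoid_product X c s" for p
      \<comment> \<open>Any competing pair is compared with \<open>c\<close> and \<open>s\<close>
        one component at a time.\<close>
      using that similar_factor_unique[OF _ c] signature_factor_unique[OF _ s]
      by (cases p) blast
  qed
qed

end
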